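(* Let $A$ be a real $m\times n$ matrix, let $s\ge 1$ be an integer, let $\{1,\dots,n\}$ be partitioned into disjoint sets $P_+$ and $P_n$, and let $\|\cdot\|$ be a norm on $\mathbb{R}^m$. Suppose that $A$ satisfies the condition $\overline{\mathbf{VSG}}_s(\xi,\sigma,\theta)$ with certain $\xi\in(0,1)$, $\sigma\ge 0$ and $\theta\ge 1$, and let $Y$ be a matrix as required in this condition. Let $w\in\mathbb{R}^n$ satisfy $w_i\ge 0$ for all $i\in P_+$ and $\|w-w^s\|_1\le\mu$, where $w^s$ is the vector obtained from $w$ by replacing all but the $s$ largest in magnitude entries of $w$ with zeros, and let $y\in\mathbb{R}^m$ be such that $\|Aw-y\|\le\delta$. Then the approximate solution $v^{(t)}$ found after $t$ iterations of the Non-Euclidean Matching Pursuit algorithm, run on $y$ with this $Y$ and with $$\tau_-=\frac{\xi}{(1+\xi\theta)s},\qquad\tau_+=\frac{\xi\theta}{(1+\xi\theta)s},\qquad\tau=\frac{\xi}{(1+\xi)s},$$ satisfies $v^{(t)}_i\ge 0$ for all $i\in P_+$ and $$\|w-v^{(t)}\|_1\le\frac{2s\sigma\delta+\mu}{1-\lambda}+\lambda^t\left[\frac{\|Y^Ty\|_{s,1}+s\sigma\delta+\mu}{1-\rho}-\frac{2s\sigma\delta+\mu}{1-\lambda}\right],$$ where $$\lambda=\max\left(\frac{\xi+\xi\theta}{1+\xi\theta},\ \frac{2\xi}{1+\xi}\right)<1,\qquad\rho=\frac{\xi\theta}{1+\xi\theta}.$$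
   Context: Notation: $\|z\|_*=\max\{z^Tx:\|x\|\le 1\}$ is the norm conjugate to $\|\cdot\|$; $\|x\|_{s,1}$ is the sum of the $s$ largest magnitudes of entries of $x\in\mathbb{R}^n$; $[a]_+=\max[0,a]$; $a\vee b=\max[a,b]$. Ties in the definition of $w^s$ are broken arbitrarily. Condition $\overline{\mathbf{VSG}}_s(\xi,\sigma,\theta)$ on $A$: there exists an $m\times n$ matrix $Y=[y_1,\dots,y_n]$ such that $\|y_i\|_*\le\sigma$ for all $i$ and - $-\frac{\xi}{(1+\xi)s}\le[I-Y^TA]_{ij}\le\frac{\xi}{(1+\xi)s}$ for all $i\notin P_+$ and all $j$; - $-\frac{\xi}{(1+\xi\theta)s}\le[I-Y^TA]_{ij}\le\frac{\xi}{(1+\xi\theta)s}$ for all $i\in P_+$ and all $j\notin P_+$; - $-\frac{\xi}{(1+\xi\theta)s}\le[I-Y^TA]_{ij}\le\frac{\xi\theta}{(1+\xi\theta)s}$ for all $i,j\in P_+$. Non-Euclidean Matching Pursuit algorithm (inputs $A$, $Y$, $y$, $s$, $\sigma$, $\delta$, $\mu$, $\tau,\tau_-,\tau_+\ge 0$, with $\rho=s\max\{\tau_+,\tau_-,\tau\}<1$): - Initialization: $v^{(0)}=0\in\mathbb{R}^n$ and $\alpha_0=\frac{\|Y^Ty\|_{s,1}+s\sigma\delta+\mu}{1-\rho}$. - Step $k=1,2,\dots$: given $v^{(k-1)}\in\mathbb{R}^n$ and $\alpha_{k-1}\ge 0$, compute $u=Y^T(y-Av^{(k-1)})$ and define $\Delta\in\mathbb{R}^n$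 by $\Delta_i=[u_i-\tau_-\alpha_{k-1}-\sigma\delta]_+$ for $i\in P_+$; $\Delta_i=[u_i-\tau\alpha_{k-1}-\sigma\delta]_+$ for $i\in P_n$ with $u_i\ge 0$; $\Delta_i=-[|u_i|-\tau\alpha_{k-1}-\sigma\delta]_+$ for $i\in P_n$ with $u_i<0$. Set $v^{(k)}=v^{(k-1)}+\Delta$ and $\alpha_k=s\,[2\tau\vee(\tau_-+\tau_+)]\,\alpha_{k-1}+2s\sigma\delta+\mu$. - The approximate solution found after $k$ iterations is $v^{(k)}$. *)

theory Defs
  imports "HOL-Analysis.Analysis"
begin

section \<open>Norms\<close>

definition is_norm :: "(real^'m \<Rightarrow> real) \<Rightarrow> bool" where
  "is_norm N \<longleftrightarrow>
     (\<forall>x. 0 \<le> N x) \<and>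
     (\<forall>x. N x = 0 \<longleftrightarrow> x = 0) \<and>
     (\<forall>c x. N (c *\<^sub>R x) = \<bar>c\<bar> * N x) \<and>
     (\<forall>x y. N (x + y) \<le> N x + N y)"

text \<open>The unit ball of a norm on a finite-dimensional space is nonempty and compact, so for a
  norm \<open>N\<close> this supremum is a maximum.\<close>

definition conj_norm :: "(real^'m \<Rightarrow> real) \<Rightarrow> real^'m \<Rightarrow> real" where
  "conj_norm N z = (SUP x\<in>{x. N x \<le> 1}. z \<bullet> x)"

definition l1_norm :: "real^'n \<Rightarrow> real" where
  "l1_norm x = (\<Sum>i\<in>UNIV. \<bar>x $ i\<bar>)"

section \<open>Largest entries\<close>

text \<open>\<open>I\<close> is a set of positions of the \<open>s\<close> largest in magnitude entries of \<open>x\<close> (all positions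
  when \<open>s\<close> exceeds the dimension). It need not be unique when there are ties.\<close>

definition largest_positions :: "nat \<Rightarrow> real^'n \<Rightarrow> 'n set \<Rightarrow> bool" where
  "largest_positions s x I \<longleftrightarrow>
     card I = min s CARD('n) \<and> (\<forall>i\<in>I. \<forall>j. j \<notin> I \<longrightarrow> \<bar>x $ j\<bar> \<le> \<bar>x $ i\<bar>)"

lemma largest_positions_exists:
  fixes x :: "real^'n"
  shows "\<exists>I. largest_positions s x I"
proof (induction s)
  case 0
  show ?case
    by (rule exI[of _ "{}"]) (simp add: largest_positions_def)
next
  case (Suc s)
  then obtain I where card_I: "card I = min s CARD('n)"
    and I: "\<And>i j. i \<in> I \<Longrightarrow> j \<notin> I \<Longrightarrow> \<bar>x $ j\<bar> \<le> \<bar>x $ i\<bar>"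
    by (auto simp: largest_positions_def)
  show ?case
  proof (cases "I = UNIV")
    case True
    with card_I have "largest_positions (Suc s) x I"
      by (simp add: largest_positions_def)
    then show ?thesis ..
  next
    case False
    have ne: "finite (- I)" "- I \<noteq> {}" using False by auto
    have max_exists: "\<exists>k\<in>-I. \<forall>j\<in>-I. \<bar>x $ j\<bar> \<le> \<bar>x $ k\<bar>"
    proof -
      have "Max ((\<lambda>j. \<bar>x $ j\<bar>) ` (-I)) \<in> (\<lambda>j. \<bar>x $ j\<bar>) ` (-I)"
        using ne by (intro Max_in) auto
      then obtain k where "k \<in> -I" "Max ((\<lambda>j. \<bar>x $ j\<bar>) ` (-I)) = \<bar>x $ k\<bar>"
        by auto
      moreover have "\<bar>x $ j\<bar> \<le> Max ((\<lambda>j. \<bar>x $ j\<bar>) ` (-I))" if "j \<in> -I" for j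
        using ne that by (intro Max_ge) auto
      ultimately show ?thesis by auto
    qed
    then obtain k where k: "k \<notin> I" "\<And>j. j \<notin> I \<Longrightarrow> \<bar>x $ j\<bar> \<le> \<bar>x $ k\<bar>"
      by auto
    have "card I < CARD('n)"
      using False by (intro psubset_card_mono) auto
    with card_I k I have "largest_positions (Suc s) x (insert k I)"
      by (auto simp: largest_positions_def)
    then show ?thesis ..
  qed
qed

text \<open>The norm written \<open>\<parallel>x\<parallel>\<close> with subscript \<open>s,1\<close>; the sum is the same for every admissible \<open>I\<close>.\<close>

definition s1_norm :: "nat \<Rightarrow> real^'n \<Rightarrow> real" where
  "s1_norm s x = (\<Sum>i\<in>(SOME I. largest_positions s x I). \<bar>x $ i\<bar>)"

text \<open>\<open>ws\<close> is a version of \<open>w\<close> with all but the \<open>s\<close> largest in magnitude entries replaced by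
  zeros. This is a relation because ties may be broken arbitrarily.\<close>

definition is_s_truncation :: "nat \<Rightarrow> real^'n \<Rightarrow> real^'n \<Rightarrow> bool" where
  "is_s_truncation s w ws \<longleftrightarrow>
     (\<exists>I. largest_positions s w I \<and> ws = (\<chi> i. if i \<in> I then w $ i else 0))"

section \<open>The verifiable condition\<close>

definition VSG_matrix ::
  "(real^'m \<Rightarrow> real) \<Rightarrow> 'n set \<Rightarrow> nat \<Rightarrow> real \<Rightarrow> real \<Rightarrow> real \<Rightarrow> real^'n^'m \<Rightarrow> real^'n^'m \<Rightarrow> bool"
where
  "VSG_matrix N Pplus s \<xi> \<sigma> \<theta> A Y \<longleftrightarrow>
     (\<forall>i. conj_norm N (column i Y) \<le> \<sigma>) \<and>
     (\<forall>i j. i \<notin> Pplus \<longrightarrow>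
        (mat 1 - transpose Y ** A) $ i $ j
          \<in> {- (\<xi> / ((1 + \<xi>) * real s)) .. \<xi> / ((1 + \<xi>) * real s)}) \<and>
     (\<forall>i j. i \<in> Pplus \<longrightarrow> j \<notin> Pplus \<longrightarrow>
        (mat 1 - transpose Y ** A) $ i $ j
          \<in> {- (\<xi> / ((1 + \<xi> * \<theta>) * real s)) .. \<xi> / ((1 + \<xi> * \<theta>) * real s)}) \<and>
     (\<forall>i j. i \<in> Pplus \<longrightarrow> j \<in> Pplus \<longrightarrow>
        (mat 1 - transpose Y ** A) $ i $ j
          \<in> {- (\<xi> / ((1 + \<xi> * \<theta>) * real s)) .. \<xi> * \<theta> / ((1 + \<xi> * \<theta>) * real s)})"

definition VSG_bar ::
  "(real^'m \<Rightarrow> real) \<Rightarrow> 'n set \<Rightarrow> nat \<Rightarrow> real \<Rightarrow> real \<Rightarrow> real \<Rightarrow> real^'n^'m \<Rightarrow> bool"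
where
  "VSG_bar N Pplus s \<xi> \<sigma> \<theta> A \<longleftrightarrow> (\<exists>Y. VSG_matrix N Pplus s \<xi> \<sigma> \<theta> A Y)"

section \<open>Non-Euclidean Matching Pursuit\<close>

text \<open>The algorithm state is the pair of the current approximation and the current bound \<open>\<alpha>\<close>.
  The complement of \<open>Pplus\<close> plays the role of \<open>P\<^sub>n\<close>. The algorithm is meant for nonnegative
  \<open>\<tau>, \<tau>\<^sub>-, \<tau>\<^sub>+\<close> with \<open>nemp_rho s \<tau> \<tau>\<^sub>- \<tau>\<^sub>+ < 1\<close>.\<close>

definition pos_part :: "real \<Rightarrow> real" where
  "pos_part a = max 0 a"

definition nemp_rho :: "nat \<Rightarrow> real \<Rightarrow> real \<Rightarrow> real \<Rightarrow> real" where
  "nemp_rho s \<tau> \<tau>minus \<tau>plus = real s * max \<tau>plus (max \<tau>minus \<tau>)"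

definition nemp_increment ::
  "'n set \<Rightarrow> real \<Rightarrow> real \<Rightarrow> real \<Rightarrow> real \<Rightarrow> real \<Rightarrow> real^'n \<Rightarrow> real^'n"
where
  "nemp_increment Pplus \<sigma> \<delta> \<tau> \<tau>minus \<alpha> u = (\<chi> i.
     if i \<in> Pplus then pos_part (u $ i - \<tau>minus * \<alpha> - \<sigma> * \<delta>)
     else if u $ i \<ge> 0 then pos_part (u $ i - \<tau> * \<alpha> - \<sigma> * \<delta>)
     else - pos_part (\<bar>u $ i\<bar> - \<tau> * \<alpha> - \<sigma> * \<delta>))"

primrec nemp_state ::
  "real^'n^'m \<Rightarrow> real^'n^'m \<Rightarrow> 'n set \<Rightarrow> real^'m \<Rightarrow> nat \<Rightarrow> real \<Rightarrow> real \<Rightarrow> real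
     \<Rightarrow> real \<Rightarrow> real \<Rightarrow> real \<Rightarrow> nat \<Rightarrow> (real^'n) \<times> real"
where
  "nemp_state A Y Pplus y s \<sigma> \<delta> \<mu> \<tau> \<tau>minus \<tau>plus 0 =
     (0, (s1_norm s (transpose Y *v y) + real s * \<sigma> * \<delta> + \<mu>) / (1 - nemp_rho s \<tau> \<tau>minus \<tau>plus))"
| "nemp_state A Y Pplus y s \<sigma> \<delta> \<mu> \<tau> \<tau>minus \<tau>plus (Suc k) =
     (let (v, \<alpha>) = nemp_state A Y Pplus y s \<sigma> \<delta> \<mu> \<tau> \<tau>minus \<tau>plus k;
          u = transpose Y *v (y - A *v v)
      in (v + nemp_increment Pplus \<sigma> \<delta> \<tau> \<tau>minus \<alpha> u,
          real s * max (2 * \<tau>) (\<tau>minus + \<tau>plus) * \<alpha> + 2 * real s * \<sigma> * \<delta> + \<mu>))"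

definition nemp_approx ::
  "real^'n^'m \<Rightarrow> real^'n^'m \<Rightarrow> 'n set \<Rightarrow> real^'m \<Rightarrow> nat \<Rightarrow> real \<Rightarrow> real \<Rightarrow> real
     \<Rightarrow> real \<Rightarrow> real \<Rightarrow> real \<Rightarrow> nat \<Rightarrow> real^'n"
where
  "nemp_approx A Y Pplus y s \<sigma> \<delta> \<mu> \<tau> \<tau>minus \<tau>plus k =
     fst (nemp_state A Y Pplus y s \<sigma> \<delta> \<mu> \<tau> \<tau>minus \<tau>plus k)"

end

theory Submission
  imports Defs
begin

text \<open>
  Write \<open>M = I - Y\<^sup>TA\<close>, let \<open>v\<close> be the current approximation and \<open>z = w - v\<close> the current error. Since
  the columns of \<open>Y\<close> have conjugate norm at most \<open>\<sigma>\<close>, the vector \<open>u = Y\<^sup>T(y - Av)\<close> agrees with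
  \<open>z - Mz\<close> up to \<open>\<sigma>\<delta>\<close> in every entry, and the entrywise bounds on \<open>M\<close> confine \<open>Mz\<close> in terms of
  \<open>\<parallel>z\<parallel>\<^sub>1\<close>. So each iteration observes the unknown error \<open>z\<close> itself, entry by entry, with a known
  accuracy. Thresholding this observation at exactly that accuracy gives an increment that never
  overshoots: each entry of \<open>v\<close> moves towards the corresponding entry of \<open>w\<close> without passing it.

  The proof maintains two properties (\<open>nemp_invariant\<close>): every \<open>v\<^sub>i\<close> lies between \<open>0\<close> and \<open>w\<^sub>i\<close>, and
  \<open>\<parallel>w - v\<parallel>\<^sub>1 \<le> \<alpha>\<close>. They support each other. The first one makes \<open>z\<^sub>i\<close> nonnegative on
  \<open>P\<^sub>+\<close>, which allows the asymmetric bounds \<open>-\<tau>\<^sub>-\<close>, \<open>\<tau>\<^sub>+\<close> to be used there. It also keeps the errors outside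
  the \<open>s\<close> dominant entries of \<open>w\<close> below \<open>\<bar>w\<^sub>i\<bar>\<close>, so that they sum to at most \<open>\<mu>\<close>. The \<open>s\<close> dominant
  entries each have error at most the total width of the uncertainty interval, at most
  \<open>max(2\<tau>, \<tau>\<^sub>- + \<tau>\<^sub>+)\<alpha> + 2\<sigma>\<delta>\<close>. Adding up gives precisely the recurrence that defines \<open>\<alpha>\<^sub>k\<close>
  (\<open>nemp_step\<close>). The initial value \<open>\<alpha>\<^sub>0\<close> bounds \<open>\<parallel>w\<parallel>\<^sub>1\<close> because \<open>\<rho> < 1\<close> lets the term
  \<open>\<rho>\<parallel>w\<parallel>\<^sub>1\<close> be absorbed (\<open>l1_norm_le_initial\<close>). Solving the affine recurrence, whose ratio is
  \<open>\<lambda>\<close>, gives the stated estimate.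
\<close>

section \<open>Duality between a norm and its conjugate\<close>

text \<open>The supremum defining \<open>conj_norm\<close> is over a bounded set because all norms on a
  finite-dimensional space are equivalent. The half of this used here is that \<open>N\<close>, being convex and
  hence continuous, attains a positive minimum on the Euclidean unit sphere.\<close>

lemma norm_le_is_norm:
  fixes N :: "real^'m \<Rightarrow> real"
  assumes "is_norm N"
  obtains C where "\<And>x. norm x \<le> C * N x"
proof -
  have nn: "N x \<ge> 0" and zero: "N x = 0 \<longleftrightarrow> x = 0" and scale: "N (c *\<^sub>R x) = \<bar>c\<bar> * N x"
    and tri: "N (x + x') \<le> N x + N x'" for c x x'
    using assms by (auto simp: is_norm_def)
  have "convex_on UNIV N"
  proof (rule convex_onI)
    fix t :: real and x x' :: "real^'m"
    assume "0 < t" "t < 1"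
    then show "N ((1 - t) *\<^sub>R x + t *\<^sub>R x') \<le> (1 - t) * N x + t * N x'"
      using tri[of "(1 - t) *\<^sub>R x" "t *\<^sub>R x'"] by (simp add: scale)
  qed simp
  then have "continuous_on UNIV N"
    by (intro convex_on_continuous) auto
  then have "continuous_on (sphere 0 1) N"
    using continuous_on_subset by blast
  moreover have "sphere (0 :: real^'m) 1 \<noteq> {}"
    using vector_choose_size[of 1] by (auto simp: sphere_def)
  ultimately obtain p where p: "p \<in> sphere 0 1" and min: "\<And>x. x \<in> sphere 0 1 \<Longrightarrow> N p \<le> N x"
    using continuous_attains_inf[of "sphere (0 :: real^'m) 1" N] by auto
  have "N p \<noteq> 0"
    using p by (subst zero) auto
  then have pos: "N p > 0"
    using nn[of p] by linarith
  have "norm x \<le> inverse (N p) * N x" for x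
  proof (cases "x = 0")
    case False
    then have "N p \<le> N (inverse (norm x) *\<^sub>R x)"
      by (intro min) simp
    with False pos show ?thesis
      by (simp add: scale field_simps)
  qed (use nn pos in simp)
  then show ?thesis by (rule that)
qed

lemma abs_inner_le_conj_norm:
  fixes N :: "real^'m \<Rightarrow> real"
  assumes N: "is_norm N"
  shows "\<bar>z \<bullet> x\<bar> \<le> conj_norm N z * N x"
proof -
  have nn: "N x \<ge> 0" and zero: "N x = 0 \<longleftrightarrow> x = 0" and scale: "N (c *\<^sub>R x) = \<bar>c\<bar> * N x" for c x
    using N by (auto simp: is_norm_def)
  obtain C where C: "\<And>x. norm x \<le> C * N x"
    using norm_le_is_norm[OF N] by blast
  have "z \<bullet> x \<le> norm z * \<bar>C\<bar>" if "N x \<le> 1" for x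
  proof -
    have "norm x \<le> \<bar>C\<bar> * N x"
      using C[of x] nn[of x] by (meson abs_ge_self mult_right_mono order_trans)
    also have "\<dots> \<le> \<bar>C\<bar>"
      using that by (simp add: mult_left_le)
    finally have "norm z * norm x \<le> norm z * \<bar>C\<bar>"
      by (simp add: mult_left_mono)
    then show ?thesis
      using norm_cauchy_schwarz[of z x] by linarith
  qed
  then have bdd: "bdd_above ((\<lambda>x. z \<bullet> x) ` {x. N x \<le> 1})"
    by (auto intro!: bdd_aboveI2)
  have one_sided: "z \<bullet> x \<le> conj_norm N z * N x" for x
  proof (cases "x = 0")
    case False
    then have pos: "N x > 0"
      using nn[of x] zero[of x] by linarith
    then have "z \<bullet> (inverse (N x) *\<^sub>R x) \<le> conj_norm N z"
      unfolding conj_norm_def by (intro cSUP_upper bdd) (simp add: scale)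
    with pos show ?thesis
      by (simp add: field_simps)
  qed (use zero[of 0] in simp)
  have "N (- x) = N x"
    using scale[of "-1" x] by simp
  then show ?thesis
    using one_sided[of x] one_sided[of "- x"] by (simp add: abs_le_iff)
qed

lemma abs_transpose_mult_le:
  fixes N :: "real^'m \<Rightarrow> real" and Y :: "real^'n^'m"
  assumes N: "is_norm N" and \<sigma>: "conj_norm N (column i Y) \<le> \<sigma>" and "\<sigma> \<ge> 0" and r: "N r \<le> \<delta>"
  shows "\<bar>(transpose Y *v r) $ i\<bar> \<le> \<sigma> * \<delta>"
proof -
  have "(transpose Y *v r) $ i = column i Y \<bullet> r"
    by (simp add: matrix_vector_mult_def transpose_def column_def inner_vec_def)
  then have "\<bar>(transpose Y *v r) $ i\<bar> \<le> conj_norm N (column i Y) * N r"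
    using abs_inner_le_conj_norm[OF N] by simp
  also have "\<dots> \<le> \<sigma> * \<delta>"
    using N \<sigma> r \<open>\<sigma> \<ge> 0\<close> by (intro mult_mono) (auto simp: is_norm_def)
  finally show ?thesis .
qed

section \<open>Sums of dominant entries\<close>

text \<open>Positions chosen by \<open>J\<close> but not among the largest can be exchanged injectively for unused
  largest positions, which only increases the sum.\<close>

lemma sum_le_s1_norm:
  fixes x :: "real^'n"
  assumes "card J \<le> s"
  shows "(\<Sum>i\<in>J. \<bar>x $ i\<bar>) \<le> s1_norm s x"
proof -
  define I where "I = (SOME I. largest_positions s x I)"
  have "largest_positions s x I"
    unfolding I_def using largest_positions_exists by (rule someI_ex)
  then have card_I: "card I = min s CARD('n)"
    and I: "\<And>i j. i \<in> I \<Longrightarrow> j \<notin> I \<Longrightarrow> \<bar>x $ j\<bar> \<le> \<bar>x $ i\<bar>"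
    by (auto simp: largest_positions_def)
  have "card J \<le> card I"
    using assms card_I card_mono[of UNIV J] by simp
  then have "card (J - I) \<le> card (I - J)"
    using card_Diff_subset_Int[of J I] card_Diff_subset_Int[of I J]
    by (simp add: Int_commute)
  then obtain f where f: "f ` (J - I) \<subseteq> I - J" "inj_on f (J - I)"
    using card_le_inj[of "J - I" "I - J"] by auto
  have "(\<Sum>i\<in>J - I. \<bar>x $ i\<bar>) \<le> (\<Sum>i\<in>J - I. \<bar>x $ f i\<bar>)"
    using f(1) I by (intro sum_mono) blast
  also have "\<dots> = (\<Sum>i\<in>f ` (J - I). \<bar>x $ i\<bar>)"
    using f(2) by (simp add: sum.reindex)
  also have "\<dots> \<le> (\<Sum>i\<in>I - J. \<bar>x $ i\<bar>)"
    using f(1) by (intro sum_mono2) auto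
  finally have "(\<Sum>i\<in>J. \<bar>x $ i\<bar>) \<le> (\<Sum>i\<in>I. \<bar>x $ i\<bar>)"
    using sum.Int_Diff[of J "\<lambda>i. \<bar>x $ i\<bar>" I] sum.Int_Diff[of I "\<lambda>i. \<bar>x $ i\<bar>" J]
    by (simp add: Int_commute)
  then show ?thesis
    by (simp add: s1_norm_def I_def)
qed

text \<open>Splits an error vector into \<open>s\<close> dominant entries, to be bounded one by one, and a remainder
  that the tail of \<open>w\<close> controls.\<close>

lemma s_truncation_l1_norm_split:
  fixes w :: "real^'n"
  assumes "is_s_truncation s w ws"
  obtains I where "card I \<le> s"
    and "\<And>e. (\<And>i. \<bar>e $ i\<bar> \<le> \<bar>w $ i\<bar>) \<Longrightarrow> l1_norm e \<le> (\<Sum>i\<in>I. \<bar>e $ i\<bar>) + l1_norm (w - ws)"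
proof -
  obtain I where I: "largest_positions s w I" and ws: "ws = (\<chi> i. if i \<in> I then w $ i else 0)"
    using assms by (auto simp: is_s_truncation_def)
  have "card I \<le> s"
    using I by (simp add: largest_positions_def)
  moreover have "l1_norm e \<le> (\<Sum>i\<in>I. \<bar>e $ i\<bar>) + l1_norm (w - ws)"
    if e: "\<And>i. \<bar>e $ i\<bar> \<le> \<bar>w $ i\<bar>" for e
  proof -
    have "(\<Sum>i\<in>- I. \<bar>e $ i\<bar>) \<le> (\<Sum>i\<in>- I. \<bar>(w - ws) $ i\<bar>)"
      using e by (intro sum_mono) (simp add: ws)
    also have "\<dots> \<le> l1_norm (w - ws)"
      unfolding l1_norm_def by (intro sum_mono2) auto
    finally show ?thesis
      using sum.subset_diff[of I UNIV "\<lambda>i. \<bar>e $ i\<bar>"]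
      by (simp add: l1_norm_def Compl_eq_Diff_UNIV)
  qed
  ultimately show ?thesis by (rule that)
qed

lemma l1_norm_nonneg: "l1_norm x \<ge> 0"
  by (simp add: l1_norm_def sum_nonneg)

lemma matrix_vector_mult_entry_bounds:
  fixes M :: "real^'n^'k"
  assumes "\<And>j. - a * \<bar>z $ j\<bar> \<le> M $ i $ j * z $ j" and "\<And>j. M $ i $ j * z $ j \<le> b * \<bar>z $ j\<bar>"
    and z: "l1_norm z \<le> \<alpha>" and "a \<ge> 0" and "b \<ge> 0"
  shows "(M *v z) $ i \<in> {- a * \<alpha> .. b * \<alpha>}"
proof -
  have "(M *v z) $ i \<le> b * l1_norm z"
    unfolding matrix_vector_mult_def l1_norm_def sum_distrib_left using assms(2) by (auto intro: sum_mono)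
  moreover have "- a * l1_norm z \<le> (M *v z) $ i"
    unfolding matrix_vector_mult_def l1_norm_def sum_distrib_left using assms(1) by (auto intro: sum_mono)
  moreover have "a * l1_norm z \<le> a * \<alpha>" "b * l1_norm z \<le> b * \<alpha>"
    using assms by (auto intro: mult_left_mono)
  ultimately show ?thesis by simp
qed

lemma abs_matrix_vector_mult_entry_le:
  fixes M :: "real^'n^'k"
  assumes M: "\<And>j. \<bar>M $ i $ j\<bar> \<le> c" and z: "l1_norm z \<le> \<alpha>"
  shows "\<bar>(M *v z) $ i\<bar> \<le> c * \<alpha>"
proof -
  have "\<bar>M $ i $ j * z $ j\<bar> \<le> c * \<bar>z $ j\<bar>" for j
    using M[of j] by (simp add: abs_mult mult_right_mono)
  then have "- c * \<bar>z $ j\<bar> \<le> M $ i $ j * z $ j \<and> M $ i $ j * z $ j \<le> c * \<bar>z $ j\<bar>" for j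
    by (smt (verit) mult_minus_left)
  moreover have "c \<ge> 0"
    using M by (meson abs_ge_zero order_trans)
  ultimately have "(M *v z) $ i \<in> {- c * \<alpha> .. c * \<alpha>}"
    using z by (intro matrix_vector_mult_entry_bounds) auto
  then show ?thesis by (auto simp: abs_le_iff)
qed

section \<open>One iteration\<close>

definition sign_split_bounds ::
  "'n set \<Rightarrow> real \<Rightarrow> real \<Rightarrow> real \<Rightarrow> real^'n^'n \<Rightarrow> bool"
where
  "sign_split_bounds Pplus \<tau> \<tau>minus \<tau>plus M \<longleftrightarrow>
     (\<forall>i j. i \<notin> Pplus \<longrightarrow> \<bar>M $ i $ j\<bar> \<le> \<tau>) \<and>
     (\<forall>i j. i \<in> Pplus \<longrightarrow> j \<notin> Pplus \<longrightarrow> \<bar>M $ i $ j\<bar> \<le> \<tau>minus) \<and>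
     (\<forall>i j. i \<in> Pplus \<longrightarrow> j \<in> Pplus \<longrightarrow> M $ i $ j \<in> {- \<tau>minus .. \<tau>plus})"

definition nemp_invariant :: "real^'n \<Rightarrow> real^'n \<Rightarrow> real \<Rightarrow> bool" where
  "nemp_invariant w v \<alpha> \<longleftrightarrow>
     (\<forall>i. v $ i \<in> closed_segment 0 (w $ i)) \<and> l1_norm (w - v) \<le> \<alpha>"

text \<open>The thresholds are the radii of the uncertainty about the error \<open>z = w - v\<close> given \<open>u\<close>, so the
  increment is the element of smallest magnitude in the interval where \<open>z\<^sub>i\<close> is known to lie. For
  \<open>i \<in> P\<^sub>+\<close> the interval is asymmetric and truncated at \<open>0\<close>. Hence \<open>v\<^sub>i\<close> does not pass \<open>w\<^sub>i\<close>,
  and the remaining error is at most the length of the interval.\<close>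

lemma nemp_increment_entry:
  fixes M :: "real^'n^'n" and w v u :: "real^'n"
  assumes M: "sign_split_bounds Pplus \<tau> \<tau>minus \<tau>plus M"
    and \<tau>: "0 \<le> \<tau>minus" "\<tau>minus \<le> \<tau>plus"
    and w: "\<And>i. i \<in> Pplus \<Longrightarrow> w $ i \<ge> 0"
    and inv: "nemp_invariant w v \<alpha>"
    and u: "\<bar>u $ i - ((w - v) - M *v (w - v)) $ i\<bar> \<le> \<sigma> * \<delta>"
  defines "v_new \<equiv> v + nemp_increment Pplus \<sigma> \<delta> \<tau> \<tau>minus \<alpha> u"
  shows "v_new $ i \<in> closed_segment 0 (w $ i)"
    and "\<bar>(w - v_new) $ i\<bar> \<le> max (2 * \<tau>) (\<tau>minus + \<tau>plus) * \<alpha> + 2 * \<sigma> * \<delta>"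
proof -
  define z where "z = w - v"
  have seg: "\<And>j. v $ j \<in> closed_segment 0 (w $ j)" and z_le: "l1_norm z \<le> \<alpha>"
    using inv by (auto simp: nemp_invariant_def z_def)
  have "\<alpha> \<ge> 0"
    using z_le l1_norm_nonneg[of z] by linarith
  have u': "\<bar>u $ i - (z $ i - (M *v z) $ i)\<bar> \<le> \<sigma> * \<delta>"
    using u by (simp add: z_def)
  have "v_new $ i \<in> closed_segment 0 (w $ i) \<and>
    \<bar>(w - v_new) $ i\<bar> \<le> max (2 * \<tau>) (\<tau>minus + \<tau>plus) * \<alpha> + 2 * \<sigma> * \<delta>"
  proof (cases "i \<in> Pplus")
    case True
    have znn: "z $ j \<ge> 0" if "j \<in> Pplus" for j
      using seg[of j] w[OF that] by (auto simp: z_def closed_segment_eq_real_ivl)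
    have entry: "- \<tau>minus * \<bar>z $ j\<bar> \<le> M $ i $ j * z $ j \<and> M $ i $ j * z $ j \<le> \<tau>plus * \<bar>z $ j\<bar>" for j
    proof (cases "j \<in> Pplus")
      case j: True
      then have "- \<tau>minus \<le> M $ i $ j" "M $ i $ j \<le> \<tau>plus"
        using M True by (auto simp: sign_split_bounds_def)
      then show ?thesis
        using znn[OF j] mult_right_mono[of "- \<tau>minus" "M $ i $ j" "z $ j"]
          mult_right_mono[of "M $ i $ j" \<tau>plus "z $ j"] by simp
    next
      case False
      then have "\<bar>M $ i $ j\<bar> \<le> \<tau>minus"
        using M True by (auto simp: sign_split_bounds_def)
      then have "\<bar>M $ i $ j * z $ j\<bar> \<le> \<tau>minus * \<bar>z $ j\<bar>"
        by (simp add: abs_mult mult_right_mono)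
      moreover have "\<tau>minus * \<bar>z $ j\<bar> \<le> \<tau>plus * \<bar>z $ j\<bar>"
        using \<tau> by (simp add: mult_right_mono)
      ultimately show ?thesis
        by (simp add: abs_le_iff)
    qed
    have Mz: "(M *v z) $ i \<in> {- \<tau>minus * \<alpha> .. \<tau>plus * \<alpha>}"
      by (intro matrix_vector_mult_entry_bounds) (use entry z_le \<tau> in auto)
    have "(\<tau>minus + \<tau>plus) * \<alpha> \<le> max (2 * \<tau>) (\<tau>minus + \<tau>plus) * \<alpha>"
      using \<open>\<alpha> \<ge> 0\<close> by (intro mult_right_mono) auto
    then have wide: "\<tau>minus * \<alpha> + \<tau>plus * \<alpha> \<le> max (2 * \<tau>) (\<tau>minus + \<tau>plus) * \<alpha>"
      by (simp add: algebra_simps)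
    have v_new: "v_new $ i = v $ i + max 0 (u $ i - \<tau>minus * \<alpha> - \<sigma> * \<delta>)"
      using True by (simp add: v_new_def nemp_increment_def pos_part_def)
    have "0 \<le> v $ i" "v $ i \<le> w $ i" "z $ i = w $ i - v $ i"
      using seg[of i] w[OF True] by (auto simp: z_def closed_segment_eq_real_ivl)
    then have "0 \<le> v_new $ i \<and> v_new $ i \<le> w $ i \<and>
      w $ i - v_new $ i \<le> \<tau>minus * \<alpha> + \<tau>plus * \<alpha> + 2 * (\<sigma> * \<delta>)"
      unfolding v_new using Mz u' \<tau> mult_nonneg_nonneg[OF \<tau>(1) \<open>\<alpha> \<ge> 0\<close>] mult_right_mono[OF \<tau>(2) \<open>\<alpha> \<ge> 0\<close>]
      by auto
    then show ?thesis
      using wide by (auto simp: closed_segment_eq_real_ivl)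
  next
    case False
    then have Mz: "\<bar>(M *v z) $ i\<bar> \<le> \<tau> * \<alpha>"
      using M z_le by (intro abs_matrix_vector_mult_entry_le) (auto simp: sign_split_bounds_def)
    have "2 * \<tau> * \<alpha> \<le> max (2 * \<tau>) (\<tau>minus + \<tau>plus) * \<alpha>"
      using \<open>\<alpha> \<ge> 0\<close> by (intro mult_right_mono) auto
    then have wide: "2 * (\<tau> * \<alpha>) \<le> max (2 * \<tau>) (\<tau>minus + \<tau>plus) * \<alpha>"
      by simp
    have v_new: "v_new $ i = v $ i + (if u $ i \<ge> 0 then max 0 (u $ i - \<tau> * \<alpha> - \<sigma> * \<delta>)
        else - max 0 (\<bar>u $ i\<bar> - \<tau> * \<alpha> - \<sigma> * \<delta>))"
      using False by (simp add: v_new_def nemp_increment_def pos_part_def)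
    have close: "\<bar>u $ i - (w $ i - v $ i)\<bar> \<le> \<tau> * \<alpha> + \<sigma> * \<delta>"
      using u' Mz by (simp add: z_def abs_le_iff)
    have between: "0 \<le> v $ i \<and> v $ i \<le> w $ i \<or> w $ i \<le> v $ i \<and> v $ i \<le> 0"
      using seg[of i] by (auto simp: closed_segment_eq_real_ivl split: if_splits)
    have "(0 \<le> v_new $ i \<and> v_new $ i \<le> w $ i \<or> w $ i \<le> v_new $ i \<and> v_new $ i \<le> 0) \<and>
      \<bar>w $ i - v_new $ i\<bar> \<le> 2 * (\<tau> * \<alpha>) + 2 * (\<sigma> * \<delta>)"
      unfolding v_new using close between by (smt (verit))
    then show ?thesis
      using wide by (auto simp: closed_segment_eq_real_ivl)
  qed
  then show "v_new $ i \<in> closed_segment 0 (w $ i)"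
    and "\<bar>(w - v_new) $ i\<bar> \<le> max (2 * \<tau>) (\<tau>minus + \<tau>plus) * \<alpha> + 2 * \<sigma> * \<delta>"
    by auto
qed

lemma nemp_step:
  fixes M :: "real^'n^'n" and w v u :: "real^'n"
  assumes M: "sign_split_bounds Pplus \<tau> \<tau>minus \<tau>plus M"
    and \<tau>: "0 \<le> \<tau>minus" "\<tau>minus \<le> \<tau>plus"
    and w: "\<And>i. i \<in> Pplus \<Longrightarrow> w $ i \<ge> 0"
    and ws: "is_s_truncation s w ws" "l1_norm (w - ws) \<le> \<mu>"
    and inv: "nemp_invariant w v \<alpha>"
    and u: "\<And>i. \<bar>u $ i - ((w - v) - M *v (w - v)) $ i\<bar> \<le> \<sigma> * \<delta>"
  shows "nemp_invariant w (v + nemp_increment Pplus \<sigma> \<delta> \<tau> \<tau>minus \<alpha> u)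
    (real s * max (2 * \<tau>) (\<tau>minus + \<tau>plus) * \<alpha> + 2 * real s * \<sigma> * \<delta> + \<mu>)"
proof -
  define v_new where "v_new = v + nemp_increment Pplus \<sigma> \<delta> \<tau> \<tau>minus \<alpha> u"
  define \<beta> where "\<beta> = max (2 * \<tau>) (\<tau>minus + \<tau>plus) * \<alpha> + 2 * \<sigma> * \<delta>"
  have seg: "v_new $ i \<in> closed_segment 0 (w $ i)" and err: "\<bar>(w - v_new) $ i\<bar> \<le> \<beta>" for i
    unfolding v_new_def \<beta>_def using nemp_increment_entry[OF M \<tau> w inv u] by auto
  obtain I where I: "card I \<le> s"
    and split: "\<And>e. (\<And>i. \<bar>e $ i\<bar> \<le> \<bar>w $ i\<bar>) \<Longrightarrow>
      l1_norm e \<le> (\<Sum>i\<in>I. \<bar>e $ i\<bar>) + l1_norm (w - ws)"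
    using s_truncation_l1_norm_split[OF ws(1)] by blast
  have "\<bar>(w - v_new) $ i\<bar> \<le> \<bar>w $ i\<bar>" for i
    using seg[of i] by (auto simp: closed_segment_eq_real_ivl split: if_splits)
  then have "l1_norm (w - v_new) \<le> (\<Sum>i\<in>I. \<bar>(w - v_new) $ i\<bar>) + l1_norm (w - ws)"
    by (rule split)
  also have "\<dots> \<le> (\<Sum>i\<in>I. \<bar>(w - v_new) $ i\<bar>) + \<mu>"
    using ws(2) by simp
  also have "(\<Sum>i\<in>I. \<bar>(w - v_new) $ i\<bar>) \<le> real (card I) * \<beta>"
    using err by (intro sum_bounded_above)
  also have "real (card I) * \<beta> \<le> real s * \<beta>"
    using I err by (intro mult_right_mono) (auto intro: order_trans[OF abs_ge_zero])
  finally have "l1_norm (w - v_new) \<le> real s * \<beta> + \<mu>"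
    by simp
  then show ?thesis
    using seg by (simp add: nemp_invariant_def v_new_def \<beta>_def algebra_simps)
qed

section \<open>The initial bound and the recurrence\<close>

text \<open>Each \<open>w\<^sub>i\<close> differs from \<open>g\<^sub>i\<close> by at most \<open>c\<parallel>w\<parallel>\<^sub>1 + \<epsilon>\<close>. Adding this up over the dominant
  entries gives \<open>\<parallel>w\<parallel>\<^sub>1 \<le> sc\<parallel>w\<parallel>\<^sub>1 + \<dots>\<close>, and the first term moves to the left.\<close>

lemma l1_norm_le_initial:
  fixes M :: "real^'n^'n" and w g :: "real^'n"
  assumes M: "\<And>i j. \<bar>M $ i $ j\<bar> \<le> c" and c: "real s * c < 1"
    and ws: "is_s_truncation s w ws" "l1_norm (w - ws) \<le> \<mu>"
    and g: "\<And>i. \<bar>g $ i - (w - M *v w) $ i\<bar> \<le> \<epsilon>"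
  shows "l1_norm w \<le> (s1_norm s g + real s * \<epsilon> + \<mu>) / (1 - real s * c)"
proof -
  obtain I where I: "card I \<le> s"
    and split: "\<And>e. (\<And>i. \<bar>e $ i\<bar> \<le> \<bar>w $ i\<bar>) \<Longrightarrow>
      l1_norm e \<le> (\<Sum>i\<in>I. \<bar>e $ i\<bar>) + l1_norm (w - ws)"
    using s_truncation_l1_norm_split[OF ws(1)] by blast
  have entry: "\<bar>w $ i\<bar> \<le> \<bar>g $ i\<bar> + (c * l1_norm w + \<epsilon>)" for i
    using g[of i] abs_matrix_vector_mult_entry_le[OF M, of w "l1_norm w" i] by simp
  have nn: "0 \<le> c * l1_norm w + \<epsilon>"
    using M g l1_norm_nonneg[of w] by (meson abs_ge_zero add_nonneg_nonneg mult_nonneg_nonneg order_trans)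
  have "(\<Sum>i\<in>I. \<bar>w $ i\<bar>) \<le> (\<Sum>i\<in>I. \<bar>g $ i\<bar> + (c * l1_norm w + \<epsilon>))"
    using entry by (intro sum_mono)
  also have "\<dots> = (\<Sum>i\<in>I. \<bar>g $ i\<bar>) + real (card I) * (c * l1_norm w + \<epsilon>)"
    by (simp add: sum.distrib)
  also have "\<dots> \<le> s1_norm s g + real s * (c * l1_norm w + \<epsilon>)"
    using I nn by (intro add_mono sum_le_s1_norm mult_right_mono) auto
  finally have "l1_norm w \<le> s1_norm s g + real s * (c * l1_norm w + \<epsilon>) + \<mu>"
    using split[of w] ws(2) by simp
  then show ?thesis
    using c by (simp add: pos_le_divide_eq algebra_simps)
qed

lemma nemp_state_alpha:
  fixes A Y :: "real^'n^'m" and Pplus :: "'n set" and y :: "real^'m" and s :: nat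
    and \<sigma> \<delta> \<mu> \<tau> \<tau>minus \<tau>plus :: real
  defines "state \<equiv> nemp_state A Y Pplus y s \<sigma> \<delta> \<mu> \<tau> \<tau>minus \<tau>plus"
    and "lam \<equiv> real s * max (2 * \<tau>) (\<tau>minus + \<tau>plus)"
    and "c \<equiv> 2 * real s * \<sigma> * \<delta> + \<mu>"
  assumes "lam < 1"
  shows "snd (state t) = c / (1 - lam) + lam ^ t * (snd (state 0) - c / (1 - lam))"
proof (induction t)
  case 0
  show ?case by simp
next
  case (Suc t)
  have fixpoint: "lam * (c / (1 - lam)) + c = c / (1 - lam)"
    using \<open>lam < 1\<close> by (simp add: field_simps)
  have "snd (state (Suc t)) = lam * snd (state t) + c"
    by (simp add: state_def lam_def c_def Let_def split_beta)
  also have "\<dots> = (lam * (c / (1 - lam)) + c) + lam ^ Suc t * (snd (state 0) - c / (1 - lam))"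
    unfolding Suc.IH by (simp add: algebra_simps)
  finally show ?case
    unfolding fixpoint .
qed

lemma nemp_state_invariant:
  fixes A Y :: "real^'n^'m" and w :: "real^'n"
  assumes M: "sign_split_bounds Pplus \<tau> \<tau>minus \<tau>plus (mat 1 - transpose Y ** A)"
    and \<tau>: "0 \<le> \<tau>minus" "\<tau>minus \<le> \<tau>plus" and \<rho>: "nemp_rho s \<tau> \<tau>minus \<tau>plus < 1"
    and w: "\<And>i. i \<in> Pplus \<Longrightarrow> w $ i \<ge> 0"
    and ws: "is_s_truncation s w ws" "l1_norm (w - ws) \<le> \<mu>"
    and noise: "\<And>i. \<bar>(transpose Y *v (A *v w - y)) $ i\<bar> \<le> \<sigma> * \<delta>"
  defines "state \<equiv> nemp_state A Y Pplus y s \<sigma> \<delta> \<mu> \<tau> \<tau>minus \<tau>plus"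
  shows "nemp_invariant w (fst (state t)) (snd (state t))"
proof -
  define M' where "M' = mat 1 - transpose Y ** A"
  have obs: "\<bar>(transpose Y *v (y - A *v v)) $ i - ((w - v) - M' *v (w - v)) $ i\<bar> \<le> \<sigma> * \<delta>" for v i
  proof -
    (* y - Av = A(w - v) - (Aw - y), and Y^T A = I - M' *)
    have "transpose Y *v (y - A *v v) - ((w - v) - M' *v (w - v)) = - (transpose Y *v (A *v w - y))"
      by (simp add: M'_def matrix_vector_mult_diff_rdistrib matrix_vector_mult_diff_distrib
          flip: matrix_vector_mul_assoc)
    then have "(transpose Y *v (y - A *v v)) $ i - ((w - v) - M' *v (w - v)) $ i =
        - (transpose Y *v (A *v w - y)) $ i"
      by (metis vector_minus_component vector_uminus_component)
    then show ?thesis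
      using noise[of i] by simp
  qed
  show ?thesis
  proof (induction t)
    case 0
    let ?c = "max \<tau>plus (max \<tau>minus \<tau>)"
    have "\<bar>M' $ i $ j\<bar> \<le> ?c" for i j
    proof -
      consider "\<bar>M' $ i $ j\<bar> \<le> \<tau>" | "\<bar>M' $ i $ j\<bar> \<le> \<tau>minus" | "M' $ i $ j \<in> {- \<tau>minus .. \<tau>plus}"
        using M[folded M'_def] unfolding sign_split_bounds_def by blast
      then show ?thesis
        using \<tau> by cases auto
    qed
    moreover have "\<bar>(transpose Y *v y) $ i - (w - M' *v w) $ i\<bar> \<le> \<sigma> * \<delta>" for i
      using obs[of 0 i] by simp
    ultimately have "l1_norm w \<le> (s1_norm s (transpose Y *v y) + real s * (\<sigma> * \<delta>) + \<mu>) / (1 - real s * ?c)"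
      using \<rho> ws by (intro l1_norm_le_initial) (auto simp: nemp_rho_def)
    then show ?case
      by (simp add: nemp_invariant_def state_def nemp_rho_def mult.assoc)
  next
    case (Suc t)
    then show ?case
      using nemp_step[OF M[folded M'_def] \<tau> w ws Suc.IH obs]
      by (simp add: state_def Let_def split_beta)
  qed
qed

section \<open>Geometric convergence\<close>

theorem corollary8p1:
  fixes A Y :: "real^'n^'m" and N :: "real^'m \<Rightarrow> real" and Pplus :: "'n set"
    and s t :: nat and \<xi> \<sigma> \<theta> \<delta> \<mu> \<tau> \<tau>minus \<tau>plus lam \<rho> :: real
    and w ws :: "real^'n" and y :: "real^'m"
  assumes "s \<ge> 1"
    and "is_norm N"
    and "0 < \<xi>" and "\<xi> < 1" and "\<sigma> \<ge> 0" and "\<theta> \<ge> 1"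
    and "VSG_bar N Pplus s \<xi> \<sigma> \<theta> A"
    and "VSG_matrix N Pplus s \<xi> \<sigma> \<theta> A Y"
    and "\<forall>i\<in>Pplus. w $ i \<ge> 0"
    and "is_s_truncation s w ws"
    and "l1_norm (w - ws) \<le> \<mu>"
    and "N (A *v w - y) \<le> \<delta>"
    and "\<tau>minus = \<xi> / ((1 + \<xi> * \<theta>) * real s)"
    and "\<tau>plus = \<xi> * \<theta> / ((1 + \<xi> * \<theta>) * real s)"
    and "\<tau> = \<xi> / ((1 + \<xi>) * real s)"
    and "lam = max ((\<xi> + \<xi> * \<theta>) / (1 + \<xi> * \<theta>)) (2 * \<xi> / (1 + \<xi>))"
    and "\<rho> = \<xi> * \<theta> / (1 + \<xi> * \<theta>)"
  shows "lam < 1 \<and>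
    (\<forall>i\<in>Pplus. nemp_approx A Y Pplus y s \<sigma> \<delta> \<mu> \<tau> \<tau>minus \<tau>plus t $ i \<ge> 0) \<and>
    l1_norm (w - nemp_approx A Y Pplus y s \<sigma> \<delta> \<mu> \<tau> \<tau>minus \<tau>plus t)
      \<le> (2 * real s * \<sigma> * \<delta> + \<mu>) / (1 - lam)
        + lam ^ t * ((s1_norm s (transpose Y *v y) + real s * \<sigma> * \<delta> + \<mu>) / (1 - \<rho>)
                     - (2 * real s * \<sigma> * \<delta> + \<mu>) / (1 - lam))"
proof -
  let ?st = "nemp_state A Y Pplus y s \<sigma> \<delta> \<mu> \<tau> \<tau>minus \<tau>plus"
  note \<tau>_defs = assms(13-15)
  have s: "real s > 0" and \<xi>: "0 < \<xi>" "\<xi> < 1" and \<theta>: "\<theta> \<ge> 1" and w: "\<And>i. i \<in> Pplus \<Longrightarrow> w $ i \<ge> 0"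
    using assms by auto
  have \<xi>\<theta>: "\<xi> \<le> \<xi> * \<theta>" "\<xi> * \<theta> > 0"
    using \<xi> \<theta> by auto
  have s\<tau>: "real s * \<tau>minus = \<xi> / (1 + \<xi> * \<theta>)" "real s * \<tau>plus = \<xi> * \<theta> / (1 + \<xi> * \<theta>)"
    "real s * \<tau> = \<xi> / (1 + \<xi>)"
    using s by (auto simp: \<tau>_defs)
  have "0 \<le> real s * \<tau>minus" "real s * \<tau>minus \<le> real s * \<tau>plus"
    unfolding s\<tau> using \<xi> \<xi>\<theta> by (auto intro: divide_right_mono)
  with s have \<tau>: "0 \<le> \<tau>minus" "\<tau>minus \<le> \<tau>plus"
    by (auto simp: zero_le_mult_iff)
  have "a / (1 + a) \<le> b / (1 + b)" if "0 < a" "a \<le> b" for a b :: real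
    using that by (simp add: field_simps)
  then have "real s * \<tau> \<le> real s * \<tau>plus"
    unfolding s\<tau> using \<xi> \<xi>\<theta> by blast
  with s have \<tau>_le: "\<tau> \<le> \<tau>plus"
    by simp
  have \<rho>: "nemp_rho s \<tau> \<tau>minus \<tau>plus = \<rho>"
    using \<tau> \<tau>_le s\<tau> assms(17) by (simp add: nemp_rho_def max_absorb1)
  have \<rho>_less: "\<rho> < 1"
    using \<xi>\<theta> assms(17) by simp
  have lam: "real s * max (2 * \<tau>) (\<tau>minus + \<tau>plus) = lam"
  proof -
    have "real s * max (2 * \<tau>) (\<tau>minus + \<tau>plus) =
        max (2 * (real s * \<tau>)) (real s * \<tau>minus + real s * \<tau>plus)"
      using s by (simp add: max_mult_distrib_left algebra_simps)
    also have "\<dots> = lam"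
      unfolding s\<tau> assms(16) by (simp add: add_divide_distrib max.commute)
    finally show ?thesis .
  qed
  have lam_less: "lam < 1"
  proof -
    have "(\<xi> + \<xi> * \<theta>) / (1 + \<xi> * \<theta>) < 1"
      using \<xi> \<xi>\<theta>(2) by (intro iffD2[OF pos_divide_less_eq]) simp_all
    then show ?thesis
      using \<xi> assms(16) by simp
  qed
  have abs_iff: "\<bar>a\<bar> \<le> b \<longleftrightarrow> a \<in> {- b .. b}" for a b :: real
    by auto
  have M: "sign_split_bounds Pplus \<tau> \<tau>minus \<tau>plus (mat 1 - transpose Y ** A)"
    using assms(8) unfolding VSG_matrix_def sign_split_bounds_def \<tau>_defs abs_iff by blast
  have noise: "\<bar>(transpose Y *v (A *v w - y)) $ i\<bar> \<le> \<sigma> * \<delta>" for i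
    using assms(2,5,8,12) by (intro abs_transpose_mult_le) (auto simp: VSG_matrix_def)
  have inv: "nemp_invariant w (fst (?st t)) (snd (?st t))"
    using nemp_state_invariant[OF M \<tau> _ w assms(10,11) noise] \<rho> \<rho>_less by simp
  have "fst (?st t) $ i \<ge> 0" if "i \<in> Pplus" for i
    using inv w[OF that] by (auto simp: nemp_invariant_def closed_segment_eq_real_ivl dest!: spec[of _ i])
  moreover have "l1_norm (w - fst (?st t)) \<le> snd (?st t)"
    using inv by (simp add: nemp_invariant_def)
  moreover note nemp_state_alpha[of s \<tau> \<tau>minus \<tau>plus A Y Pplus y \<sigma> \<delta> \<mu> t, unfolded lam, OF lam_less]
  ultimately show ?thesis
    using lam_less by (simp add: nemp_approx_def \<rho>)
qed

end
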